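(* Let $\rho$ be a positive integer that is a palindrome in base $10$ (i.e. $r(\rho)=\rho$) and whose decimal digits are all $0$'s and $1$'s. Then $18\rho$ is a $v$-palindrome.
   Context: For an integer $n\geq 1$, $r(n)$ denotes the number formed by writing the decimal digits of $n$ in reverse order. The function $v\colon\mathbb{N}\to\mathbb{Z}$ is the additive arithmetic function (i.e. $v(mn)=v(m)+v(n)$ whenever $\gcd(m,n)=1$, and $v(1)=0$) determined on prime powers by $v(p)=p$ and $v(p^\alpha)=p+\alpha$ for $\alpha\geq 2$. An integer $n\geq 1$ is a $v$-palindrome if $10\nmid n$, $n\neq r(n)$, and $v(n)=v(r(n))$. *)

theory Defs
  imports Complex_Main "HOL-Computational_Algebra.Primes"
begin

text \<open>Decimal digits, least significant first and without leading zeros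
  (so \<open>digits 0 = []\<close>).\<close>

fun digits :: "nat \<Rightarrow> nat list" where
  "digits n = (if n = 0 then [] else n mod 10 # digits (n div 10))"

declare digits.simps [simp del]

lemma horner_sum_digits: "horner_sum id 10 (digits n) = n"
proof (induction n rule: digits.induct)
  case (1 n)
  show ?case
  proof (cases "n = 0")
    case False
    then have "horner_sum id 10 (digits n) = n mod 10 + 10 * horner_sum id 10 (digits (n div 10))"
      by (subst digits.simps) simp
    also have "\<dots> = n"
      unfolding 1[OF False] by simp
    finally show ?thesis .
  qed (simp add: digits.simps)
qed

text \<open>Since \<open>horner_sum\<close> also reads the least significant digit first, trailing zeros
  of \<open>n\<close> become leading zeros of the reversal and disappear.\<close>

definition r :: "nat \<Rightarrow> nat" where
  "r n = horner_sum id 10 (rev (digits n))"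

text \<open>The explicit formula for the additive function with \<open>v p = p\<close> and
  \<open>v (p ^ \<alpha>) = p + \<alpha>\<close> for \<open>\<alpha> \<ge> 2\<close>. The lemmas below show that it has these properties
  and that they determine it on the positive integers; its value at 0 is irrelevant.\<close>

definition v :: "nat \<Rightarrow> int" where
  "v n = (\<Sum>p\<in>prime_factors n.
            if multiplicity p n = 1 then int p else int p + int (multiplicity p n))"

lemma v_1: "v 1 = 0"
  by (simp add: v_def)

lemma v_prime_power:
  assumes "prime p" "\<alpha> \<ge> 1"
  shows "v (p ^ \<alpha>) = (if \<alpha> = 1 then int p else int p + int \<alpha>)"
proof -
  have "prime_factors (p ^ \<alpha>) = {p}"
    using assms by (auto simp: prime_factors_dvd prime_dvd_power_iff primes_dvd_imp_eq)
  moreover have "multiplicity p (p ^ \<alpha>) = \<alpha>"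
    using assms by (intro multiplicity_same_power) auto
  ultimately show ?thesis unfolding v_def by (simp only: sum.insert finite.emptyI) simp
qed

lemma v_prime: "prime p \<Longrightarrow> v p = int p"
  using v_prime_power[of p 1] by simp

lemma v_mult_coprime:
  assumes "m > 0" "n > 0" "coprime m n"
  shows "v (m * n) = v m + v n"
proof -
  let ?t = "\<lambda>p k. if k = 1 then int p else int p + int k"
  have disj: "prime_factors m \<inter> prime_factors n = {}"
    using assms by (auto simp: prime_factors_dvd dest: coprime_common_divisor_nat)
  have mult: "multiplicity p (m * n) = multiplicity p m + multiplicity p n" if "prime p" for p
    using that assms by (simp add: prime_elem_multiplicity_mult_distrib)
  have m: "multiplicity p (m * n) = multiplicity p m" if "p \<in> prime_factors m" for p
  proof -
    have "p \<notin> prime_factors n" using that disj by blast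
    then have "multiplicity p n = 0"
      using that assms by (intro not_dvd_imp_multiplicity_0) (auto simp: prime_factors_dvd)
    then show ?thesis using that by (simp add: mult in_prime_factors_imp_prime)
  qed
  have n: "multiplicity p (m * n) = multiplicity p n" if "p \<in> prime_factors n" for p
  proof -
    have "p \<notin> prime_factors m" using that disj by blast
    then have "multiplicity p m = 0"
      using that assms by (intro not_dvd_imp_multiplicity_0) (auto simp: prime_factors_dvd)
    then show ?thesis using that by (simp add: mult in_prime_factors_imp_prime)
  qed
  have "prime_factors (m * n) = prime_factors m \<union> prime_factors n"
    using assms by (intro prime_factors_product) auto
  then have "v (m * n) = (\<Sum>p\<in>prime_factors m. ?t p (multiplicity p (m * n)))
      + (\<Sum>p\<in>prime_factors n. ?t p (multiplicity p (m * n)))"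
    unfolding v_def using disj by (simp add: sum.union_disjoint)
  also have "\<dots> = v m + v n"
    unfolding v_def by (intro arg_cong2[where f = "(+)"] sum.cong) (simp_all add: m n)
  finally show ?thesis .
qed

lemma v_unique:
  fixes f :: "nat \<Rightarrow> int"
  assumes one: "f 1 = 0"
    and add: "\<And>m n. m > 0 \<Longrightarrow> n > 0 \<Longrightarrow> coprime m n \<Longrightarrow> f (m * n) = f m + f n"
    and prime: "\<And>p. prime p \<Longrightarrow> f p = int p"
    and power: "\<And>p \<alpha>. prime p \<Longrightarrow> \<alpha> \<ge> 2 \<Longrightarrow> f (p ^ \<alpha>) = int p + int \<alpha>"
    and "n > 0"
  shows "f n = v n"
  using \<open>n > 0\<close>
proof (induction n rule: less_induct)
  case (less n)
  show ?case
  proof (cases "n = 1")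
    case True
    then show ?thesis using one v_1 by simp
  next
    case False
    then obtain p where p: "prime p" "p dvd n"
      using prime_factor_nat by blast
    define k where "k = multiplicity p n"
    have k: "k \<ge> 1"
      using p less.prems unfolding k_def
      by (metis One_nat_def Suc_leI multiplicity_gt_zero_iff not_prime_unit not_gr_zero)
    obtain m where m: "n = p ^ k * m" "\<not> p dvd m"
      using multiplicity_decompose'[of n p] p less.prems not_prime_unit
      unfolding k_def by (metis not_gr_zero)
    have "m > 0" using m less.prems by (cases m) auto
    have pk: "p ^ k > 1" using p k prime_gt_1_nat[of p] by (intro one_less_power) auto
    have "m < n" using pk \<open>m > 0\<close> m(1) by simp
    have cop: "coprime (p ^ k) m" using p m(2) by (simp add: prime_imp_coprime)
    have "f (p ^ k) = v (p ^ k)"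
      using k prime[OF p(1)] power[OF p(1), of k] v_prime_power[OF p(1) k]
      by (cases "k = 1") auto
    moreover have "f m = v m" using less.IH \<open>m < n\<close> \<open>m > 0\<close> by blast
    ultimately show ?thesis
      using add[OF _ \<open>m > 0\<close> cop] v_mult_coprime[OF _ \<open>m > 0\<close> cop] prime_gt_0_nat[OF p(1)] m(1)
      by simp
  qed
qed

definition v_palindrome :: "nat \<Rightarrow> bool" where
  "v_palindrome n \<longleftrightarrow> n \<ge> 1 \<and> \<not> 10 dvd n \<and> n \<noteq> r n \<and> v n = v (r n)"

end

theory Submission
  imports Defs
begin

text \<open>Since the digits of \<open>\<rho>\<close> are at most 1, adding \<open>8 \<rho>\<close> and \<open>10 \<rho>\<close> produces no carry, so
  the digits of \<open>18 \<rho> = 8 \<rho> + 10 \<rho>\<close> are the digitwise sums. Reversing them swaps the roles of the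
  two shifts, whence \<open>r (18 \<rho>) = 80 \<rho> + \<rho> = 81 \<rho>\<close>. As \<open>\<rho>\<close> is odd, with \<open>\<rho> = 3 ^ a * m\<close> both
  \<open>v (18 \<rho>) = 2 + (3 + (a + 2)) + v m\<close> and \<open>v (81 \<rho>) = (3 + (a + 4)) + v m\<close>.\<close>

lemma last_digits: "n > 0 \<Longrightarrow> last (digits n) \<noteq> 0"
proof (induction n rule: digits.induct)
  case (1 n)
  show ?case
  proof (cases "n div 10 = 0")
    case True
    then show ?thesis using 1(2) by (simp add: digits.simps[of n] digits.simps[of 0])
  next
    case False
    then have "digits (n div 10) \<noteq> []" by (subst digits.simps) simp
    then show ?thesis using 1 False by (simp add: digits.simps[of n])
  qed
qed

text \<open>Uniqueness of the decimal expansion, a nonzero last entry ruling out leading zeros. It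
  certifies a carry-free sum as the digit list of \<open>18 * n\<close>.\<close>

lemma digits_horner_sum:
  assumes "\<forall>d\<in>set ds. d < 10" "ds \<noteq> [] \<Longrightarrow> last ds \<noteq> 0"
  shows "digits (horner_sum id 10 ds) = ds"
  using assms
proof (induction ds)
  case Nil
  then show ?case by (simp add: digits.simps)
next
  case (Cons d ds)
  have IH: "digits (horner_sum id 10 ds) = ds"
    using Cons by (auto simp: id_def split: if_splits)
  have "horner_sum id 10 (d # ds) \<noteq> 0"
    using Cons.prems IH by (auto simp: id_def digits.simps[of 0])
  then show ?case
    using Cons.prems IH by (subst digits.simps) (simp add: id_def)
qed

text \<open>Equal lengths take the place of a nonzero top digit: a reversed digit list may a priori
  end in 0.\<close>

lemma horner_sum_eq_imp_eq:
  fixes xs ys :: "nat list"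
  assumes "length xs = length ys" "\<forall>d\<in>set xs. d < b" "\<forall>d\<in>set ys. d < b"
    and "horner_sum id b xs = horner_sum id b ys"
  shows "xs = ys"
  using assms
proof (induction xs ys rule: list_induct2)
  case (Cons x xs y ys)
  then have eq: "x + b * horner_sum id b xs = y + b * horner_sum id b ys"
    by (simp add: id_def)
  have "x < b" "y < b" using Cons.prems by auto
  then have "x = y" "horner_sum id b xs = horner_sum id b ys"
    using arg_cong[OF eq, of "\<lambda>n. n mod b"] arg_cong[OF eq, of "\<lambda>n. n div b"] by auto
  then show ?case using Cons by simp
qed simp

lemma horner_sum_map2_add:
  fixes xs ys :: "nat list"
  assumes "length xs = length ys"
  shows "horner_sum id b (map2 (\<lambda>x y. c * x + y) xs ys) = c * horner_sum id b xs + horner_sum id b ys"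
  using assms by (induction xs ys rule: list_induct2) (simp_all add: algebra_simps)

lemma r_18_mult:
  assumes "n > 0" "set (digits n) \<subseteq> {0, 1}"
  shows "r (18 * n) = 81 * r n"
proof -
  define ds where "ds = digits n"
  \<comment> \<open>With the least significant digit first, \<open>0 # ds\<close> represents
    \<open>10 * n\<close>, and \<open>ds @ [0]\<close> is \<open>n\<close> padded to the same
    length.\<close>
  define xs where "xs = map2 (\<lambda>x y. 8 * x + y) (ds @ [0]) (0 # ds)"
  have "ds \<noteq> []" using assms(1) unfolding ds_def by (subst digits.simps) simp
  have "horner_sum id 10 xs = 18 * n"
    unfolding xs_def by (subst horner_sum_map2_add) (simp_all add: horner_sum_append ds_def horner_sum_digits)
  moreover have "digits (horner_sum id 10 xs) = xs"
  proof (rule digits_horner_sum)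
    have "8 * x + y < 10" if "x \<in> set (ds @ [0])" "y \<in> set (0 # ds)" for x y
    proof -
      have "x \<le> 1" "y \<le> 1" using that assms(2) unfolding ds_def by auto
      then show ?thesis by simp
    qed
    then show "\<forall>d\<in>set xs. d < 10"
      unfolding xs_def by (auto simp only: set_map dest: set_zip_leftD set_zip_rightD)
    \<comment> \<open>The padding contributes 0 at the top, leaving the leading digit of
      \<open>n\<close>.\<close>
    have "last xs = 8 * last (ds @ [0]) + last (0 # ds)"
      unfolding xs_def by (subst last_map) (auto simp: last_zip zip_append simp del: last_snoc)
    then show "last xs \<noteq> 0"
      using \<open>ds \<noteq> []\<close> last_digits[OF assms(1)] by (simp add: ds_def)
  qed
  ultimately have "r (18 * n) = horner_sum id 10 (rev xs)" by (simp add: r_def)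
  \<comment> \<open>Now the summand with weight 8 is the shifted one: 8 * 10 + 1 = 81.\<close>
  also have "rev xs = map2 (\<lambda>x y. 8 * x + y) (0 # rev ds) (rev ds @ [0])"
    unfolding xs_def by (simp add: rev_map zip_rev[symmetric] del: zip_Cons_Cons list.map)
  also have "horner_sum id 10 \<dots> = 81 * r n"
    by (subst horner_sum_map2_add) (simp_all add: horner_sum_append r_def ds_def)
  finally show ?thesis by simp
qed

text \<open>The prime 2 contributes 2 on the left, which the two extra factors 3 make up for on the
  right.\<close>

lemma v_18_mult_eq_v_81_mult:
  assumes "odd n"
  shows "v (18 * n) = v (81 * n)"
proof -
  have "n > 0" using assms by (cases n) auto
  obtain m where m: "n = 3 ^ multiplicity 3 n * m" "\<not> 3 dvd m"
    using multiplicity_decompose'[of n 3] \<open>n > 0\<close> by auto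
  define a where "a = multiplicity 3 n"
  have n: "n = 3 ^ a * m" using m(1) by (simp add: a_def)
  have "odd m" "m > 0" using assms \<open>n > 0\<close> n by auto
  have prime3: "prime (3::nat)" by simp
  have cop: "coprime (3 ^ k) m" for k
    using prime_imp_coprime[OF prime3 m(2)] by simp
  \<comment> \<open>Used for \<open>k = a + 2\<close> and \<open>k = a + 4\<close>, which both avoid
    the exceptional exponent 1.\<close>
  have "v (3 ^ k * m) = 3 + int k + v m" if "k \<ge> 2" for k
    using that v_mult_coprime[OF _ \<open>m > 0\<close> cop] v_prime_power[OF prime3, of k] by simp
  moreover have "v (2 * (3 ^ k * m)) = 2 + v (3 ^ k * m)" for k
    using v_mult_coprime[of 2 "3 ^ k * m"] v_prime[of 2] \<open>odd m\<close> \<open>m > 0\<close> by simp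
  moreover have "18 * n = 2 * (3 ^ (a + 2) * m)" "81 * n = 3 ^ (a + 4) * m"
    by (simp_all add: n power_add)
  ultimately show ?thesis by (simp only:)
qed

theorem theorem5p1:
  fixes \<rho> :: nat
  assumes "\<rho> > 0"
    and "r \<rho> = \<rho>"
    and "set (digits \<rho>) \<subseteq> {0, 1}"
  shows "v_palindrome (18 * \<rho>)"
proof -
  have r: "r (18 * \<rho>) = 81 * \<rho>"
    using r_18_mult[OF assms(1,3)] assms(2) by simp
  \<comment> \<open>The symmetry makes the units digit equal to the nonzero leading digit, hence 1;
    so \<open>\<rho>\<close> is odd and \<open>18 * \<rho>\<close> ends in 8.\<close>
  have "rev (digits \<rho>) = digits \<rho>"
    using assms(2,3) by (intro horner_sum_eq_imp_eq[where b = 10]) (auto simp: r_def horner_sum_digits)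
  then have "hd (digits \<rho>) = last (digits \<rho>)"
    by (metis hd_rev)
  moreover have digits: "digits \<rho> = \<rho> mod 10 # digits (\<rho> div 10)"
    using assms(1) by (subst digits.simps) simp
  ultimately have "\<rho> mod 10 \<noteq> 0"
    using last_digits[OF assms(1)] by (metis list.sel(1))
  then have "\<rho> mod 10 = 1"
    using assms(3) digits by auto
  then have "odd \<rho>" "\<not> 10 dvd 18 * \<rho>" by presburger+
  then show ?thesis
    using assms(1) r v_18_mult_eq_v_81_mult by (simp add: v_palindrome_def)
qed

end
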